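(* For every $\delta\in[0,1)$ and every $\alpha\in(\delta/3,1/3)$ there exists $\epsilon>0$ with the following property. For all constants $0<c_1\le c_2$ there are $C>0$ and $n_0$ such that for all $n\ge n_0$, every prime $p$ with $c_1n^\alpha\le p\le c_2 n^\alpha$, every integer $\ell\le n+n^\delta$ and every $(\epsilon\log n)$-local function $f:\{0,1\}^\ell\to\{0,1\}^{n+1}$, $$\Delta\big(f(U),\,(X,\mathrm{majmod}_p(X)\oplus\mathrm{parity}(X))\big)\ \ge\ \tfrac12-\tfrac{C}{\log n},$$ where $U$ is uniform on $\{0,1\}^\ell$ and $X$ is uniform on $\{0,1\}^n$.
   Context: For $x\in\{0,1\}^k$ let $|x|=\sum_i x_i$ be its Hamming weight, $\mathrm{parity}(x)=|x|\bmod 2$, and for an odd prime $p$, $\mathrm{majmod}_p(x)=0$ if $(|x|\bmod p)<p/2$ and $\mathrm{majmod}_p(x)=1$ otherwise (here $a\bmod p\in\{0,\dots,p-1\}$). A function $f:\{0,1\}^\ell\to\{0,1\}^m$ is $d$-local if each output bit depends on at most $d$ input bits. For distributions $D_1,D_2$ on $\{0,1\}^m$, the total variation distance is $\Delta(D_1,D_2)=\max_{T\subseteq\{0,1\}^m}|\Pr[D_1\in T]-\Pr[D_2\in T]|$. $(X,g(X))$ denotes the distribution of the concatenation of $X$ with the bit $g(X)$. *)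

theory Defs
  imports "HOL-Probability.Probability_Mass_Function" "HOL-Computational_Algebra.Primes"
begin

text \<open>Bit strings in {0,1}^k are boolean lists of length k (True = 1).\<close>

definition bitstrings :: "nat \<Rightarrow> bool list set" where
  "bitstrings k = {xs. length xs = k}"

definition hweight :: "bool list \<Rightarrow> nat" where
  "hweight x = length (filter id x)"

definition parity :: "bool list \<Rightarrow> bool" where
  "parity x = odd (hweight x)"

text \<open>majmod_p(x) = 0 iff (|x| mod p) < p/2; written as 2*(|x| mod p) < p.\<close>
definition majmod :: "nat \<Rightarrow> bool list \<Rightarrow> bool" where
  "majmod p x = (\<not> (2 * (hweight x mod p) < p))"

definition uniform_bits :: "nat \<Rightarrow> bool list pmf" where
  "uniform_bits k = pmf_of_set (bitstrings k)"

definition tv_dist :: "'a pmf \<Rightarrow> 'a pmf \<Rightarrow> real" where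
  "tv_dist D1 D2 = (SUP T. \<bar>measure_pmf.prob D1 T - measure_pmf.prob D2 T\<bar>)"

definition is_local :: "real \<Rightarrow> nat \<Rightarrow> nat \<Rightarrow> (bool list \<Rightarrow> bool list) \<Rightarrow> bool" where
  "is_local d l m f \<longleftrightarrow>
     (\<forall>x \<in> bitstrings l. length (f x) = m) \<and>
     (\<forall>i < m. \<exists>S \<subseteq> {..<l}. real (card S) \<le> d \<and>
        (\<forall>x \<in> bitstrings l. \<forall>y \<in> bitstrings l.
           (\<forall>j \<in> S. x ! j = y ! j) \<longrightarrow> f x ! i = f y ! i))"

end

theory Submission
  imports Defs "HOL-Probability.Hoeffding" "HOL-Number_Theory.Cong" "HOL-Real_Asymp.Real_Asymp"
begin

text \<open>
  Strings are identified with the sets of their true positions. If the seed has fewer than \<open>n\<close>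
  bits, the support of the sampler is too small. Otherwise \<open>d\<close>-locality yields a set \<open>J\<close> of
  \<open>n / polylog n\<close> seed bits that influence pairwise disjoint blocks of at most \<open>4 d\<close> output bits
  each and do not influence the last bit. Fix the seed \<open>Y\<close> outside \<open>J\<close>; every bit of \<open>J\<close> then
  switches its own block between two contents.

  If many bits of \<open>J\<close> are inert (their two contents coincide), then all such \<open>Y\<close> together
  produce few outputs, since the seed is only slightly longer than \<open>n\<close>. A uniform string vanishes
  on many blocks, so an output vanishing on few of them is suspicious as well. In the remaining
  case many bits of \<open>J\<close> switch their block between zero and a nonzero string, hence change the
  Hamming weight by a nonzero amount smaller than \<open>p\<close>. Expanding the majority mod \<open>p\<close> into
  characters shows that the correct last bit is then almost balanced, whereas the sampled one is
  constant: the sampler errs with probability close to one half.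
\<close>

section \<open>Uniformly random subsets\<close>

abbreviation random_subset :: "'a set \<Rightarrow> 'a set pmf" where
  "random_subset A \<equiv> pmf_of_set (Pow A)"

lemma prob_pmf_of_set_le:
  assumes "finite A" "A \<noteq> {}" "finite S"
  shows "measure_pmf.prob (pmf_of_set A) S \<le> card S / card A"
  using assms by (auto simp: measure_pmf_of_set intro!: divide_right_mono card_mono)

lemma prob_bind_pmf_ge:
  assumes "\<And>x. x \<in> set_pmf M \<Longrightarrow> c \<le> measure_pmf.prob (K x) T"
  shows "c \<le> measure_pmf.prob (bind_pmf M K) T"
proof -
  have "ennreal c = (\<integral>\<^sup>+x. ennreal c \<partial>measure_pmf M)"
    by simp
  also have "\<dots> \<le> (\<integral>\<^sup>+x. emeasure (measure_pmf (K x)) T \<partial>measure_pmf M)"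
    using assms by (intro nn_integral_mono_AE)
      (simp add: AE_measure_pmf_iff measure_pmf.emeasure_eq_measure ennreal_leI)
  finally show ?thesis
    by (simp add: measure_pmf.emeasure_eq_measure[of "bind_pmf M K", symmetric] flip: ennreal_le_iff)
qed

lemma set_pmf_random_subset: "finite A \<Longrightarrow> set_pmf (random_subset A) = Pow A"
  by (simp add: Pow_not_empty)

lemma integrable_random_subset:
  fixes f :: "'a set \<Rightarrow> 'b::{banach, second_countable_topology}"
  assumes "finite A"
  shows "integrable (measure_pmf (random_subset A)) f"
  using assms by (intro integrable_measure_pmf_finite) (simp add: set_pmf_random_subset)

lemma random_subset_Un:
  assumes "finite A" "finite B" "A \<inter> B = {}"
  shows "random_subset (A \<union> B)
    = bind_pmf (random_subset A) (\<lambda>Y. map_pmf (\<lambda>Z. Y \<union> Z) (random_subset B))"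
proof -
  have "bij_betw (\<lambda>(Y, Z). Y \<union> Z) (Pow A \<times> Pow B) (Pow (A \<union> B))"
    using assms(3) by (intro bij_betw_byWitness[where f' = "\<lambda>X. (X \<inter> A, X \<inter> B)"]) auto
  then have "random_subset (A \<union> B) = map_pmf (\<lambda>(Y, Z). Y \<union> Z) (pmf_of_set (Pow A \<times> Pow B))"
    using assms(1,2) by (intro map_pmf_of_set_bij_betw[symmetric]) auto
  also have "pmf_of_set (Pow A \<times> Pow B) = pair_pmf (random_subset A) (random_subset B)"
    using assms(1,2) by (intro pmf_eqI)
      (auto simp: pmf_pair indicator_def card_cartesian_product Pow_not_empty)
  finally show ?thesis
    by (simp add: pair_pmf_def map_pmf_def bind_assoc_pmf bind_return_pmf)
qed

lemma (in prob_space) indep_vars_distrI: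
  assumes f [measurable]: "f \<in> measurable M N"
    and X: "\<And>i. i \<in> I \<Longrightarrow> X i \<in> measurable N (M' i)"
    and indep: "indep_vars M' (\<lambda>i x. X i (f x)) I"
  shows "prob_space.indep_vars (distr M N f) M' X I"
proof -
  interpret D: prob_space "distr M N f"
    using f by (rule prob_space_distr)
  have Xf: "(\<lambda>x. X i (f x)) \<in> measurable M (M' i)" if "i \<in> I" for i
    using measurable_compose[OF f X[OF that]] .
  show ?thesis
  proof (cases "I = {}")
    case False
    have "distr (distr M N f) (PiM I M') (\<lambda>x. \<lambda>i\<in>I. X i x)
        = distr M (PiM I M') (\<lambda>x. \<lambda>i\<in>I. X i (f x))"
      using X by (subst distr_distr) (auto intro!: measurable_restrict simp: comp_def)
    also have "\<dots> = PiM I (\<lambda>i. distr M (M' i) (\<lambda>x. X i (f x)))"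
      using indep False Xf by (simp add: indep_vars_iff_distr_eq_PiM')
    also have "\<dots> = PiM I (\<lambda>i. distr (distr M N f) (M' i) (X i))"
      using X by (intro PiM_cong) (simp_all add: distr_distr comp_def)
    finally show ?thesis
      using False X by (simp add: D.indep_vars_iff_distr_eq_PiM')
  qed (simp add: D.indep_vars_def2 D.indep_sets_def)
qed

lemma indep_vars_random_subset_blocks:
  assumes "finite N" "\<And>j. j \<in> J \<Longrightarrow> B j \<subseteq> N" "disjoint_family_on B J"
  shows "prob_space.indep_vars (measure_pmf (random_subset N)) (\<lambda>_. count_space UNIV)
    (\<lambda>j X. X \<inter> B j) J"
proof -
  let ?coins = "measure_pmf (Pi_pmf N False (\<lambda>_. bernoulli_pmf (1 / 2)))"
  have prob: "prob_space ?coins"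
    by (rule prob_space_measure_pmf)
  have restrict_Int: "{i\<in>B j. restrict b (B j) i} = {i\<in>N. b i} \<inter> B j" if "j \<in> J" for j b
    using assms(2)[OF that] by auto
  have "prob_space.indep_vars ?coins (\<lambda>j. PiM (B j) (\<lambda>_. count_space UNIV))
      (\<lambda>j b. restrict b (B j)) J"
    using prob_space.indep_vars_restrict[OF prob indep_vars_Pi_pmf[OF assms(1)] assms(2,3)] by simp
  then have "prob_space.indep_vars ?coins (\<lambda>_. count_space UNIV)
      (\<lambda>j b. {i\<in>B j. restrict b (B j) i}) J"
  proof (rule prob_space.indep_vars_compose2[OF prob])
    fix j assume "j \<in> J"
    then have "finite (B j)"
      using assms(1,2) finite_subset by blast
    then show "(\<lambda>g. {i\<in>B j. g i}) \<in> measurable (PiM (B j) (\<lambda>_. count_space UNIV)) (count_space UNIV)"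
      by (simp add: count_space_PiM_finite)
  qed
  then have "prob_space.indep_vars ?coins (\<lambda>_. count_space UNIV) (\<lambda>j b. {i\<in>N. b i} \<inter> B j) J"
    by (subst (asm) prob_space.indep_vars_cong[OF prob refl _ refl]) (use restrict_Int in auto)
  then show ?thesis
    unfolding pmf_of_set_Pow_conv_bernoulli[OF assms(1), of False, symmetric] map_pmf_rep_eq
    by (intro prob_space.indep_vars_distrI[OF prob]) auto
qed

section \<open>Characters and Fourier inversion\<close>

lemma expectation_prod_random_subset:
  fixes u v :: "'a \<Rightarrow> 'b::{real_normed_field, banach, second_countable_topology}"
  assumes "finite I"
  shows "measure_pmf.expectation (random_subset I) (\<lambda>Z. \<Prod>i\<in>I. if i \<in> Z then u i else v i)
    = (\<Prod>i\<in>I. (u i + v i) / 2)"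
proof -
  have split: "(\<Prod>i\<in>I. if i \<in> Z then u i else v i) = (\<Prod>i\<in>Z. u i) * (\<Prod>i\<in>I - Z. v i)"
    if "Z \<in> Pow I" for Z
    using assms that by (simp add: prod.If_cases Int_absorb1 Diff_eq)
  have "measure_pmf.expectation (random_subset I) (\<lambda>Z. \<Prod>i\<in>I. if i \<in> Z then u i else v i)
      = (\<Sum>Z\<in>Pow I. (1 / 2 ^ card I) *\<^sub>R (\<Prod>i\<in>I. if i \<in> Z then u i else v i))"
    using assms by (subst integral_measure_pmf[of "Pow I"]) (auto simp: Pow_not_empty card_Pow)
  also have "\<dots> = (\<Prod>i\<in>I. u i + v i) / 2 ^ card I"
    using assms split by (simp add: prod_add sum_divide_distrib scaleR_conv_of_real)
  finally show ?thesis
    by (simp add: prod_dividef)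
qed

definition choice_sum :: "nat \<Rightarrow> ('a \<Rightarrow> nat) \<Rightarrow> ('a \<Rightarrow> nat) \<Rightarrow> 'a set \<Rightarrow> 'a set \<Rightarrow> nat" where
  "choice_sum c a b I Z = c + (\<Sum>i\<in>I. if i \<in> Z then a i else b i)"

lemma expectation_power_choice_sum:
  fixes z :: "'b::{real_normed_field, banach, second_countable_topology}"
  assumes "finite I"
  shows "measure_pmf.expectation (random_subset I) (\<lambda>Z. z ^ choice_sum c a b I Z)
    = z ^ c * (\<Prod>i\<in>I. (z ^ a i + z ^ b i) / 2)"
proof -
  have "z ^ choice_sum c a b I Z = z ^ c * (\<Prod>i\<in>I. if i \<in> Z then z ^ a i else z ^ b i)" for Z
    by (simp add: choice_sum_def power_add power_sum if_distrib)
  then show ?thesis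
    by (simp add: expectation_prod_random_subset[OF assms])
qed

lemma root_unity_power_mod:
  fixes z :: "'a::monoid_mult"
  assumes "z ^ m = 1"
  shows "z ^ (k mod m) = z ^ k"
proof -
  have "z ^ k = z ^ (m * (k div m) + k mod m)"
    by simp
  then show ?thesis
    by (simp only: power_add power_mult assms power_one mult_1_left)
qed

lemma root_unity_power_cong:
  fixes z :: "'a::monoid_mult"
  assumes "z ^ m = 1" "[i = j] (mod m)"
  shows "z ^ i = z ^ j"
  using assms(2) root_unity_power_mod[OF assms(1), of i] root_unity_power_mod[OF assms(1), of j]
  by (simp add: cong_def)

lemma root_unity_power:
  fixes z :: "'a::monoid_mult"
  assumes "z ^ m = 1"
  shows "(z ^ k) ^ m = 1"
proof -
  have "(z ^ k) ^ m = (z ^ m) ^ k"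
    by (simp only: power_mult[symmetric] mult.commute)
  then show ?thesis
    by (simp add: assms)
qed

lemma norm_root_unity_minus_one_ge:
  fixes z :: complex
  assumes "z ^ m = 1" "z \<noteq> 1" "m > 0"
  shows "1 / m \<le> norm (z - 1)"
proof -
  have norm_eq_1: "norm z = 1"
    using power_eq_1_iff[OF assms(1)] assms(3) by simp
  have "(\<Sum>k<m. z ^ k) = 0"
    using assms(1,2) by (simp add: geometric_sum)
  then have "real m = norm (\<Sum>k<m. z ^ k - 1 ^ k)"
    by (simp add: sum_subtractf)
  also have "\<dots> \<le> (\<Sum>k<m. m * norm (z - 1))"
  proof (rule sum_norm_le)
    fix k assume "k \<in> {..<m}"
    have "norm (z ^ k - 1 ^ k) \<le> k * norm (z - 1)"
      using norm_eq_1 by (intro norm_power_diff) simp_all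
    also have "\<dots> \<le> m * norm (z - 1)"
      using \<open>k \<in> {..<m}\<close> by (intro mult_right_mono) simp_all
    finally show "norm (z ^ k - 1 ^ k) \<le> m * norm (z - 1)" .
  qed
  finally show ?thesis
    using assms(3) by (simp add: field_simps)
qed

lemma norm_mean_unit_le_exp:
  fixes u v :: complex
  assumes "norm u = 1" "norm v = 1" "u ^ m = v ^ m" "u \<noteq> v" "m > 0"
  shows "norm ((u + v) / 2) \<le> exp (- 1 / (8 * (real m)\<^sup>2))"
proof -
  have "v \<noteq> 0"
    using assms(2) by auto
  then have "1 / m \<le> norm (u / v - 1)"
    using assms by (intro norm_root_unity_minus_one_ge) (auto simp: power_divide)
  also have "u / v - 1 = (u - v) / v"
    using \<open>v \<noteq> 0\<close> by (simp add: field_simps)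
  also have "norm \<dots> = norm (u - v)"
    using assms(2) by (simp add: norm_divide)
  finally have chord_ge: "(1 / m)\<^sup>2 \<le> (norm (u - v))\<^sup>2"
    by (intro power_mono) auto
  have "(norm (u + v))\<^sup>2 + (norm (u - v))\<^sup>2 = 2 * (norm u)\<^sup>2 + 2 * (norm v)\<^sup>2"
    unfolding cmod_power2 by (simp add: power2_eq_square algebra_simps)
  then have "(norm ((u + v) / 2))\<^sup>2 \<le> 1 + (- 1 / (4 * (real m)\<^sup>2))"
    using chord_ge assms(1,2) by (simp add: norm_divide power_divide field_simps)
  also have "\<dots> \<le> exp (- 1 / (4 * (real m)\<^sup>2))"
    by (rule exp_ge_add_one_self)
  also have "\<dots> = (exp (- 1 / (8 * (real m)\<^sup>2)))\<^sup>2"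
    by (simp add: exp_double[symmetric])
  finally show ?thesis
    by (rule power2_le_imp_le) simp
qed

lemma norm_expectation_root_unity_power_le:
  fixes z :: complex
  assumes "finite I" "K \<subseteq> I" "z ^ m = 1" "m > 0" "\<And>i. i \<in> K \<Longrightarrow> z ^ a i \<noteq> z ^ b i"
  shows "norm (measure_pmf.expectation (random_subset I) (\<lambda>Z. z ^ choice_sum c a b I Z))
    \<le> exp (- real (card K) / (8 * (real m)\<^sup>2))"
proof -
  have norm_eq_1: "norm (z ^ k) = 1" for k
    using power_eq_1_iff[OF assms(3)] assms(4) by (simp add: norm_power)
  have "norm ((z ^ a i + z ^ b i) / 2) \<le> (if i \<in> K then exp (- 1 / (8 * (real m)\<^sup>2)) else 1)" for i
  proof (cases "i \<in> K")
    case True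
    then show ?thesis
      using assms(4,5) norm_eq_1 root_unity_power[OF assms(3)]
        norm_mean_unit_le_exp[of "z ^ a i" "z ^ b i" m] by simp
  next
    case False
    then show ?thesis
      using norm_triangle_ineq[of "z ^ a i" "z ^ b i"] by (simp add: norm_divide norm_eq_1)
  qed
  then have "(\<Prod>i\<in>I. norm ((z ^ a i + z ^ b i) / 2))
      \<le> (\<Prod>i\<in>I. if i \<in> K then exp (- 1 / (8 * (real m)\<^sup>2)) else 1)"
    by (intro prod_mono) auto
  also have "\<dots> = exp (- real (card K) / (8 * (real m)\<^sup>2))"
    using assms(1,2) by (simp add: prod.If_cases Int_absorb1 exp_of_nat_mult[symmetric] flip: Int_def)
  finally show ?thesis
    unfolding expectation_power_choice_sum[OF assms(1)] norm_mult prod_norm[symmetric] norm_eq_1 by simp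
qed

lemma root_unity_mult_cnj:
  fixes z :: complex
  assumes "z ^ m = 1" "m > 0"
  shows "z * cnj z = 1"
  using power_eq_1_iff[OF assms(1)] assms(2) complex_norm_square[of z] by simp

lemma primitive_root_unity_exists:
  assumes "m > 0"
  obtains \<omega> :: complex
  where "\<forall>z. z ^ m = 1 \<longleftrightarrow> (\<exists>k. z = \<omega> ^ k)"
    "\<forall>i j. \<omega> ^ i = \<omega> ^ j \<longleftrightarrow> [i = j] (mod m)"
proof
  define \<omega> where "\<omega> = cis (2 * pi / m)"
  have "cis (2 * pi * real k / m) = \<omega> ^ k" for k
    by (simp add: \<omega>_def Complex.DeMoivre mult_ac)
  then have bij: "bij_betw (\<lambda>k. \<omega> ^ k) {..<m} {z. z ^ m = 1}"
    using Complex.bij_betw_roots_unity[OF assms] by simp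
  have root: "\<omega> ^ m = 1"
    using assms by (simp add: \<omega>_def Complex.DeMoivre)
  have "\<exists>k. z = \<omega> ^ k" if "z ^ m = 1" for z
    using bij_betw_imp_surj_on[OF bij] that by blast
  then show "\<forall>z. z ^ m = 1 \<longleftrightarrow> (\<exists>k. z = \<omega> ^ k)"
    using root_unity_power[OF root] by blast
  have "\<omega> ^ i = \<omega> ^ j \<longleftrightarrow> [i = j] (mod m)" for i j
  proof -
    have "\<omega> ^ i = \<omega> ^ j \<longleftrightarrow> \<omega> ^ (i mod m) = \<omega> ^ (j mod m)"
      by (simp only: root_unity_power_mod[OF root])
    also have "\<dots> \<longleftrightarrow> i mod m = j mod m"
      using assms by (intro inj_on_eq_iff[OF bij_betw_imp_inj_on[OF bij]]) auto
    finally show ?thesis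
      by (simp only: cong_def)
  qed
  then show "\<forall>i j. \<omega> ^ i = \<omega> ^ j \<longleftrightarrow> [i = j] (mod m)"
    by blast
qed

lemma root_unity_separates:
  assumes "m > 0" "\<not> [i = j] (mod m)"
  obtains \<omega> :: complex where "\<omega> ^ m = 1" "\<omega> ^ i \<noteq> \<omega> ^ j"
proof -
  obtain \<omega> :: complex
    where \<omega>: "\<forall>z. z ^ m = 1 \<longleftrightarrow> (\<exists>k. z = \<omega> ^ k)"
      "\<forall>i j. \<omega> ^ i = \<omega> ^ j \<longleftrightarrow> [i = j] (mod m)"
    by (rule primitive_root_unity_exists[OF assms(1)])
  have "\<omega> ^ m = 1"
    using spec[OF \<omega>(1), of \<omega>] power_one_right[of \<omega>, symmetric] by blast
  moreover have "\<omega> ^ i \<noteq> \<omega> ^ j"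
    using \<omega>(2) assms(2) by simp
  ultimately show thesis
    by (rule that)
qed

lemma sum_roots_unity_power_cnj:
  assumes "m > 0"
  shows "(\<Sum>z | z ^ m = 1. z ^ i * cnj z ^ j)
    = (if [i = j] (mod m) then of_nat m else (0::complex))"
proof (cases "[i = j] (mod m)")
  case True
  have "z ^ i * cnj z ^ j = 1" if "z ^ m = 1" for z :: complex
    using root_unity_power_cong[OF that True] root_unity_mult_cnj[OF that assms]
    by (simp flip: power_mult_distrib)
  then show ?thesis
    using True assms by (simp add: card_roots_unity_eq)
next
  case False
  then obtain \<omega> :: complex where root: "\<omega> ^ m = 1" and separates: "\<omega> ^ i \<noteq> \<omega> ^ j"
    using root_unity_separates[OF assms] by blast
  from root have cnj: "\<omega> * cnj \<omega> = 1"
    using assms by (rule root_unity_mult_cnj)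
  then have "\<omega> \<noteq> 0"
    by auto
  let ?S = "\<Sum>z | z ^ m = 1. z ^ i * cnj z ^ j"
  have "?S = (\<Sum>z | z ^ m = 1. (\<omega> * z) ^ i * cnj (\<omega> * z) ^ j)"
    using root \<open>\<omega> \<noteq> 0\<close>
    by (intro sum.reindex_bij_witness[of _ "\<lambda>z. \<omega> * z" "\<lambda>z. z / \<omega>"])
      (auto simp: power_mult_distrib power_divide)
  also have "\<dots> = \<omega> ^ i * cnj \<omega> ^ j * ?S"
    by (simp add: power_mult_distrib sum_distrib_left mult_ac)
  finally have "?S * (\<omega> ^ i * cnj \<omega> ^ j - 1) = 0"
    by (simp add: algebra_simps)
  moreover have "\<omega> ^ i * cnj \<omega> ^ j \<noteq> 1"
  proof
    assume "\<omega> ^ i * cnj \<omega> ^ j = 1"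
    then have "\<omega> ^ i * (\<omega> * cnj \<omega>) ^ j = \<omega> ^ j"
      by (simp add: power_mult_distrib)
    then show False
      using separates cnj by simp
  qed
  ultimately show ?thesis
    using False by simp
qed

definition fourier_coeff :: "nat \<Rightarrow> (nat \<Rightarrow> complex) \<Rightarrow> complex \<Rightarrow> complex" where
  "fourier_coeff m s z = (\<Sum>r<m. s r * cnj z ^ r) / m"

lemma fourier_inversion:
  assumes "m > 0" "\<And>w. s (w mod m) = s w"
  shows "s w = (\<Sum>z | z ^ m = 1. fourier_coeff m s z * z ^ w)"
proof -
  have "(\<Sum>z | z ^ m = 1. fourier_coeff m s z * z ^ w)
      = (\<Sum>z | z ^ m = 1. \<Sum>r<m. s r * (z ^ w * cnj z ^ r)) / m"
    by (simp add: fourier_coeff_def sum_divide_distrib sum_distrib_left mult_ac)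
  also have "\<dots> = (\<Sum>r<m. s r * (\<Sum>z | z ^ m = 1. z ^ w * cnj z ^ r)) / m"
    by (subst sum.swap) (simp add: sum_distrib_left)
  also have "\<dots> = (\<Sum>r<m. if r = w mod m then s r else 0)"
    unfolding sum_divide_distrib
    using assms(1) by (intro sum.cong) (auto simp: sum_roots_unity_power_cnj cong_def)
  also have "\<dots> = s w"
    using assms by simp
  finally show ?thesis ..
qed

lemma norm_fourier_coeff_le:
  assumes "z ^ m = 1" "m > 0" "\<And>r. norm (s r) \<le> 1"
  shows "norm (fourier_coeff m s z) \<le> 1"
proof -
  have "norm (\<Sum>r<m. s r * cnj z ^ r) \<le> (\<Sum>r<m. 1)"
    using assms power_eq_1_iff[OF assms(1)] by (intro sum_norm_le) (simp add: norm_mult norm_power)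
  then show ?thesis
    using assms(2) by (simp add: fourier_coeff_def norm_divide)
qed

lemma root_unity_power_eq_iff:
  fixes z :: complex
  assumes "prime p" "z ^ p = 1" "z \<noteq> 1"
  shows "z ^ i = z ^ j \<longleftrightarrow> [i = j] (mod p)"
proof
  assume "[i = j] (mod p)"
  then show "z ^ i = z ^ j"
    by (rule root_unity_power_cong[OF assms(2)])
next
  obtain \<omega> :: complex
    where \<omega>: "\<forall>z. z ^ p = 1 \<longleftrightarrow> (\<exists>k. z = \<omega> ^ k)"
      "\<forall>i j. \<omega> ^ i = \<omega> ^ j \<longleftrightarrow> [i = j] (mod p)"
    by (rule primitive_root_unity_exists[OF prime_gt_0_nat[OF assms(1)]])
  then obtain k where z: "z = \<omega> ^ k"
    using assms(2) by auto
  have "\<not> p dvd k"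
    using assms(3) spec[OF spec[OF \<omega>(2)], of k 0] by (simp add: z cong_0_iff)
  then have "coprime k p"
    using assms(1) by (metis prime_imp_coprime coprime_commute)
  moreover assume "z ^ i = z ^ j"
  then have "[k * i = k * j] (mod p)"
    by (simp add: z \<omega>(2) flip: power_mult)
  ultimately show "[i = j] (mod p)"
    by (simp add: cong_mult_lcancel_nat)
qed

lemma uminus_root_unity_power_eqD:
  fixes z :: complex
  assumes "prime p" "odd p" "z ^ p = 1" "z \<noteq> 1" "(- z) ^ i = (- z) ^ j"
  shows "[i = j] (mod p)"
proof -
  have "z ^ (2 * i) = z ^ (2 * j)"
    using arg_cong[OF assms(5), of "\<lambda>x. x\<^sup>2"]
    by (simp add: power_mult power2_eq_square flip: power_mult_distrib)
  then have "[2 * i = 2 * j] (mod p)"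
    using assms by (simp add: root_unity_power_eq_iff)
  then show ?thesis
    using assms(2) by (simp add: cong_mult_lcancel_nat)
qed

section \<open>Majority modulo an odd prime and parity of a random weight\<close>

definition majmod_parity :: "nat \<Rightarrow> nat \<Rightarrow> bool" where
  "majmod_parity p w \<longleftrightarrow> (\<not> 2 * (w mod p) < p) \<noteq> odd w"

definition majmod_sign :: "nat \<Rightarrow> nat \<Rightarrow> complex" where
  "majmod_sign p w = (if 2 * (w mod p) < p then 1 else - 1)"

lemma majmod_parity_sign_eq:
  "(if majmod_parity p w then - 1 else 1) = (- 1) ^ w * majmod_sign p w"
  by (auto simp: majmod_parity_def majmod_sign_def)

lemma sum_majmod_sign:
  assumes "odd p"
  shows "(\<Sum>r<p. majmod_sign p r) = 1"
proof -
  obtain k where p: "p = 2 * k + 1"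
    using assms by (rule oddE)
  have "(\<Sum>r<p. majmod_sign p r)
      = (\<Sum>r<k + 1. majmod_sign p r) + (\<Sum>r = k + 1..<p. majmod_sign p r)"
    unfolding lessThan_atLeast0 using p by (intro sum.atLeastLessThan_concat[symmetric]) auto
  also have "(\<Sum>r<k + 1. majmod_sign p r) = (\<Sum>r<k + 1. 1)"
    by (intro sum.cong) (auto simp: p majmod_sign_def)
  also have "(\<Sum>r = k + 1..<p. majmod_sign p r) = (\<Sum>r = k + 1..<p. - 1)"
    by (intro sum.cong) (auto simp: p majmod_sign_def)
  finally show ?thesis
    by (simp add: p)
qed

lemma majmod_parity_fourier_expansion:
  assumes "p > 0"
  shows "(if majmod_parity p w then - 1 else 1)
    = (\<Sum>z | z ^ p = 1. fourier_coeff p (majmod_sign p) z * (- z) ^ w)"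
proof -
  let ?coeff = "fourier_coeff p (majmod_sign p)"
  have "majmod_sign p w = (\<Sum>z | z ^ p = 1. ?coeff z * z ^ w)"
    using assms by (intro fourier_inversion) (simp_all add: majmod_sign_def)
  moreover have "(- 1) ^ w * (?coeff z * z ^ w) = ?coeff z * (- z) ^ w" for z
    by (simp add: power_minus[of z])
  ultimately show ?thesis
    by (simp only: majmod_parity_sign_eq sum_distrib_left)
qed

definition majmod_parity_bias :: "nat \<Rightarrow> real \<Rightarrow> real" where
  "majmod_parity_bias p t = 1 / (2 * real p) + real p / 2 * exp (- t / (32 * (real p)\<^sup>2))"

lemma majmod_parity_bias_nonneg: "0 \<le> majmod_parity_bias p t"
  by (simp add: majmod_parity_bias_def)

lemma majmod_parity_bias_antimono: "t \<le> t' \<Longrightarrow> majmod_parity_bias p t' \<le> majmod_parity_bias p t"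
  by (simp add: majmod_parity_bias_def mult_left_mono divide_right_mono)

lemma majmod_parity_bias_le:
  assumes "0 < P" "P \<le> real p" "real p \<le> Q" "0 \<le> t"
  shows "majmod_parity_bias p t \<le> 1 / (2 * P) + Q / 2 * exp (- t / (32 * Q\<^sup>2))"
proof -
  have "t / (32 * Q\<^sup>2) \<le> t / (32 * (real p)\<^sup>2)"
    using assms by (intro divide_left_mono mult_left_mono power_mono mult_pos_pos) auto
  then show ?thesis
    unfolding majmod_parity_bias_def using assms by (intro add_mono mult_mono divide_left_mono) auto
qed

text \<open>The parity character turns a \<open>p\<close>-th root of unity \<open>z\<close> into the \<open>2 p\<close>-th root of unity \<open>- z\<close>.
  If \<open>z \<noteq> 1\<close>, then \<open>- z\<close> separates any two exponents that are incongruent mod \<open>p\<close>, whatever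
  their parities; and the coefficient of \<open>z = 1\<close> is only \<open>1 / p\<close>.\<close>
lemma norm_expectation_majmod_parity_le:
  assumes "finite J" "prime p" "odd p" "K \<subseteq> J" "\<And>i. i \<in> K \<Longrightarrow> \<not> [a i = b i] (mod p)"
  shows "norm (measure_pmf.expectation (random_subset J)
      (\<lambda>Z. if majmod_parity p (choice_sum c a b J Z) then - 1 else (1::complex)))
    \<le> 2 * majmod_parity_bias p (card K)"
proof -
  let ?coeff = "fourier_coeff p (majmod_sign p)"
    and ?e = "exp (- real (card K) / (32 * (real p)\<^sup>2))"
  let ?E = "\<lambda>z::complex. measure_pmf.expectation (random_subset J)
    (\<lambda>Z. (- z) ^ choice_sum c a b J Z)"
  have "p > 0"
    using assms(2) by (rule prime_gt_0_nat)
  have trivial: "norm (?coeff 1 * ?E 1) \<le> 1 / p"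
  proof -
    have "norm (?coeff 1) = 1 / p"
      by (simp add: fourier_coeff_def sum_majmod_sign[OF assms(3)] norm_divide)
    moreover have "norm (?E 1) \<le> 1"
      using norm_expectation_root_unity_power_le[OF assms(1), of "{}" "- 1" 2] by simp
    ultimately show ?thesis
      using mult_left_mono[of "norm (?E 1)" 1 "1 / p"] by (simp add: norm_mult)
  qed
  have nontrivial: "norm (?coeff z * ?E z) \<le> ?e" if "z ^ p = 1" "z \<noteq> 1" for z
  proof -
    have "norm (?E z) \<le> exp (- real (card K) / (8 * (real (2 * p))\<^sup>2))"
      using that assms \<open>p > 0\<close> by (intro norm_expectation_root_unity_power_le)
        (auto simp: power_mult root_unity_power dest: uminus_root_unity_power_eqD)
    moreover have "norm (?coeff z) \<le> 1"
      using that(1) \<open>p > 0\<close> by (rule norm_fourier_coeff_le) (simp add: majmod_sign_def)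
    ultimately show ?thesis
      using mult_mono[of "norm (?coeff z)" 1] by (simp add: norm_mult power_mult_distrib)
  qed
  have "norm (measure_pmf.expectation (random_subset J)
      (\<lambda>Z. if majmod_parity p (choice_sum c a b J Z) then - 1 else (1::complex)))
      = norm (\<Sum>z | z ^ p = 1. ?coeff z * ?E z)"
    using assms(1) \<open>p > 0\<close> by (simp add: majmod_parity_fourier_expansion integrable_random_subset)
  also have "\<dots> \<le> (\<Sum>z::complex | z ^ p = 1. (if z = 1 then 1 / p else 0) + ?e)"
    using trivial nontrivial by (intro sum_norm_le) (auto intro: add_increasing2)
  also have "\<dots> = 2 * majmod_parity_bias p (card K)"
    using \<open>p > 0\<close>
    by (simp add: sum.distrib finite_roots_unity card_roots_unity_eq majmod_parity_bias_def)
  finally show ?thesis .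
qed

lemma prob_majmod_parity_le:
  assumes "finite J" "prime p" "odd p" "K \<subseteq> J" "\<And>i. i \<in> K \<Longrightarrow> \<not> [a i = b i] (mod p)"
  shows "measure_pmf.prob (random_subset J) {Z. majmod_parity p (choice_sum c a b J Z) = v}
    \<le> 1 / 2 + majmod_parity_bias p (card K)"
proof -
  define \<phi> where "\<phi> Z = (if majmod_parity p (choice_sum c a b J Z) then - 1 else (1::complex))" for Z
  let ?E = "measure_pmf.expectation (random_subset J)"
  let ?S = "{Z. majmod_parity p (choice_sum c a b J Z) = v}"
    and ?sign = "if v then - 1 else (1::complex)"
  have "complex_of_real (measure_pmf.prob (random_subset J) ?S)
      = ?E (\<lambda>Z. complex_of_real (indicat_real ?S Z))"
    by simp
  also have "\<dots> = ?E (\<lambda>Z. (1 + ?sign * \<phi> Z) / 2)"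
    by (intro arg_cong[where f = ?E]) (auto simp: \<phi>_def fun_eq_iff indicator_def)
  also have "\<dots> = (1 + ?sign * ?E \<phi>) / 2"
    using assms(1) by (simp add: integrable_random_subset)
  finally have "measure_pmf.prob (random_subset J) ?S = norm ((1 + ?sign * ?E \<phi>) / 2)"
    by (metis norm_of_real abs_of_nonneg measure_nonneg)
  also have "\<dots> \<le> (1 + norm (?E \<phi>)) / 2"
    using norm_triangle_ineq[of 1 "?sign * ?E \<phi>"]
    by (simp add: norm_divide norm_mult split: if_splits)
  also have "\<dots> \<le> (1 + 2 * majmod_parity_bias p (card K)) / 2"
    unfolding \<phi>_def
    by (intro divide_right_mono add_left_mono norm_expectation_majmod_parity_le assms) simp_all
  finally show ?thesis
    by (simp add: add_divide_distrib)
qed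

section \<open>Blocks avoided by a random subset\<close>

lemma prob_random_subset_avoids:
  assumes "finite N" "B \<subseteq> N"
  shows "measure_pmf.prob (random_subset N) {X. X \<inter> B = {}} = (1 / 2) ^ card B"
proof -
  have "finite B"
    using assms finite_subset by blast
  have "Pow N \<inter> {X. X \<inter> B = {}} = Pow (N - B)"
    by auto
  then have "measure_pmf.prob (random_subset N) {X. X \<inter> B = {}} = card (Pow (N - B)) / card (Pow N)"
    using assms(1) by (subst measure_pmf_of_set) (auto simp: Pow_not_empty)
  also have "\<dots> = (1 / 2) ^ card B"
  proof -
    have "card N = card (N - B) + card B"
      using assms \<open>finite B\<close> by (simp add: card_Diff_subset card_mono)
    then show ?thesis
      using assms(1) by (simp add: card_Pow power_add power_one_over)
  qed
  finally show ?thesis .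
qed

lemma prob_few_avoided_blocks_le:
  fixes q :: real
  assumes J: "finite J" and N: "finite N" and B: "\<And>j. j \<in> J \<Longrightarrow> B j \<subseteq> N" "disjoint_family_on B J"
    and q: "0 \<le> q" "\<And>j. j \<in> J \<Longrightarrow> q \<le> (1 / 2) ^ card (B j)"
  shows "measure_pmf.prob (random_subset N) {X. card {j\<in>J. X \<inter> B j = {}} \<le> q * card J / 2}
    \<le> exp (- q\<^sup>2 * card J / 2)"
proof (cases "J = {}")
  case False
  define avoids where "avoids j = indicat_real {X. X \<inter> B j = {}}" for j
  define \<mu> where "\<mu> = (\<Sum>j\<in>J. measure_pmf.expectation (random_subset N) (avoids j))"
  interpret Hoeffding_ineq "measure_pmf (random_subset N)" J avoids "\<lambda>_. 0" "\<lambda>_. 1" \<mu>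
  proof unfold_locales
    have "prob_space.indep_vars (measure_pmf (random_subset N)) (\<lambda>_. borel)
        (\<lambda>j X. indicat_real {{}} (X \<inter> B j)) J"
      using prob_space_measure_pmf indep_vars_random_subset_blocks[OF N B]
      by (rule prob_space.indep_vars_compose2) auto
    then show "prob_space.indep_vars (measure_pmf (random_subset N)) (\<lambda>_. borel) avoids J"
      by (simp add: avoids_def[abs_def] indicator_def[abs_def])
  qed (auto simp: J avoids_def \<mu>_def)
  have "(\<Sum>j\<in>J. q) \<le> \<mu>"
    unfolding \<mu>_def avoids_def using q(2) prob_random_subset_avoids[OF N B(1)]
    by (intro sum_mono) simp
  then have mean: "q * card J \<le> \<mu>"
    by (simp add: mult.commute)
  have "measure_pmf.prob (random_subset N) {X. card {j\<in>J. X \<inter> B j = {}} \<le> q * card J / 2}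
      \<le> measure_pmf.prob (random_subset N)
          {X\<in>space (measure_pmf (random_subset N)). (\<Sum>j\<in>J. avoids j X) \<le> \<mu> - q * card J / 2}"
    using J mean by (intro measure_pmf.finite_measure_mono)
      (auto simp: avoids_def indicator_def sum.If_cases Int_def)
  also have "\<dots> \<le> exp (- 2 * (q * card J / 2)\<^sup>2 / (\<Sum>j\<in>J. (1 - 0)\<^sup>2))"
    using J False q(1) by (intro Hoeffding_ineq_le) (auto simp: card_gt_0_iff)
  also have "\<dots> = exp (- q\<^sup>2 * card J / 2)"
    using J False by (simp add: power2_eq_square)
  finally show ?thesis .
qed simp

section \<open>Inputs with disjoint fanouts\<close>

lemma large_independent_set_exists:
  fixes R :: "'a \<Rightarrow> 'a \<Rightarrow> bool" and \<Delta> :: real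
  assumes V: "finite V" and R: "symp R"
    and deg: "\<And>v. v \<in> V \<Longrightarrow> card {w\<in>V. R v w} \<le> \<Delta>"
  obtains J where "J \<subseteq> V" "pairwise (\<lambda>i j. \<not> R i j) J" "card V \<le> card J * (\<Delta> + 1)"
proof -
  let ?indep = "\<lambda>J. J \<subseteq> V \<and> pairwise (\<lambda>i j. \<not> R i j) J"
  have "\<forall>J. ?indep J \<longrightarrow> card J < card V + 1"
    using V by (auto simp: less_Suc_eq_le intro: card_mono)
  then obtain J where J: "J \<subseteq> V" "pairwise (\<lambda>i j. \<not> R i j) J"
    and max: "\<And>J'. ?indep J' \<Longrightarrow> card J' \<le> card J"
    using ex_has_greatest_nat[of ?indep "{}" card "card V + 1"] by auto
  have "finite J"
    using J(1) V finite_subset by blast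
  have covered: "V \<subseteq> (\<Union>j\<in>J. insert j {w\<in>V. R j w})"
  proof
    fix v assume "v \<in> V"
    show "v \<in> (\<Union>j\<in>J. insert j {w\<in>V. R j w})"
    proof (cases "v \<in> J")
      case False
      then have "\<not> ?indep (insert v J)"
        using max[of "insert v J"] \<open>finite J\<close> by auto
      then obtain j where "j \<in> J" "R j v"
        using J \<open>v \<in> V\<close> R by (auto simp: pairwise_insert dest: sympD)
      then show ?thesis
        using \<open>v \<in> V\<close> by auto
    qed auto
  qed
  have "card (insert j {w\<in>V. R j w}) \<le> \<Delta> + 1" if "j \<in> J" for j
    using deg[of j] J(1) that V by (auto simp: card_insert_if)
  then have "(\<Sum>j\<in>J. real (card (insert j {w\<in>V. R j w}))) \<le> (\<Sum>j\<in>J. \<Delta> + 1)"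
    by (intro sum_mono)
  moreover have "card V \<le> (\<Sum>j\<in>J. card (insert j {w\<in>V. R j w}))"
    using card_mono[OF _ covered] card_UN_le[OF \<open>finite J\<close>, of "\<lambda>j. insert j {w\<in>V. R j w}"]
      \<open>finite J\<close> V by simp
  ultimately have "card V \<le> card J * (\<Delta> + 1)"
    by (simp flip: of_nat_sum)
  then show thesis
    using J that by blast
qed

definition fanout :: "'b set \<Rightarrow> ('b \<Rightarrow> 'a set) \<Rightarrow> 'a \<Rightarrow> 'b set" where
  "fanout N D j = {i\<in>N. j \<in> D i}"

lemma sum_card_fanout:
  assumes "finite L" "finite N" "\<And>i. i \<in> N \<Longrightarrow> D i \<subseteq> L"
  shows "(\<Sum>j\<in>L. card (fanout N D j)) = (\<Sum>i\<in>N. card (D i))"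
proof -
  have "(\<Sum>j\<in>L. card (fanout N D j)) = (\<Sum>i\<in>N. card {j\<in>L. j \<in> D i})"
    unfolding fanout_def card_eq_sum using assms(1,2) by (rule sum.swap_restrict)
  also have "\<dots> = (\<Sum>i\<in>N. card (D i))"
    using assms(3) by (intro sum.cong arg_cong[where f = card]) auto
  finally show ?thesis .
qed

lemma card_high_fanout_le:
  fixes c d :: real
  assumes "finite L" "finite N" "\<And>i. i \<in> N \<Longrightarrow> D i \<subseteq> L" "\<And>i. i \<in> N \<Longrightarrow> card (D i) \<le> d" "d > 0"
  shows "c * card {j\<in>L. c * d < card (fanout N D j)} \<le> card N"
proof -
  let ?high = "{j\<in>L. c * d < card (fanout N D j)}"
  have "c * card ?high * d = (\<Sum>j\<in>?high. c * d)"
    by simp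
  also have "\<dots> \<le> (\<Sum>j\<in>?high. real (card (fanout N D j)))"
    by (intro sum_mono) auto
  also have "\<dots> \<le> (\<Sum>j\<in>L. real (card (fanout N D j)))"
    using assms(1) by (intro sum_mono2) auto
  also have "\<dots> = (\<Sum>i\<in>N. real (card (D i)))"
    using sum_card_fanout[OF assms(1-3)] by (simp flip: of_nat_sum)
  also have "\<dots> \<le> card N * d"
    using assms(4) by (rule sum_bounded_above)
  finally show ?thesis
    using assms(5) by simp
qed

lemma card_overlapping_fanout_le:
  fixes d :: real
  assumes "finite N" "\<And>i. i \<in> N \<Longrightarrow> finite (D i)" "\<And>i. i \<in> N \<Longrightarrow> card (D i) \<le> d"
  shows "card {w\<in>V. fanout N D v \<inter> fanout N D w \<noteq> {}} \<le> card (fanout N D v) * d"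
proof -
  have fan: "fanout N D v \<subseteq> N" "finite (fanout N D v)"
    using assms(1) by (auto simp: fanout_def)
  have "{w\<in>V. fanout N D v \<inter> fanout N D w \<noteq> {}} \<subseteq> (\<Union>i\<in>fanout N D v. D i)"
    by (auto simp: fanout_def)
  then have "card {w\<in>V. fanout N D v \<inter> fanout N D w \<noteq> {}} \<le> card (\<Union>i\<in>fanout N D v. D i)"
    using assms(2) fan by (intro card_mono) auto
  also have "\<dots> \<le> (\<Sum>i\<in>fanout N D v. card (D i))"
    using fan(2) by (rule card_UN_le)
  finally have "real (card {w\<in>V. fanout N D v \<inter> fanout N D w \<noteq> {}})
      \<le> (\<Sum>i\<in>fanout N D v. real (card (D i)))"
    by (simp flip: of_nat_sum)
  also have "\<dots> \<le> card (fanout N D v) * d"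
    using assms(3) fan(1) by (intro sum_bounded_above) auto
  finally show ?thesis .
qed

lemma card_low_fanout_ge:
  fixes d :: real
  assumes "finite L" "finite N" "card N \<le> card L"
    and "\<And>i. i \<in> N \<Longrightarrow> D i \<subseteq> L" "\<And>i. i \<in> N \<Longrightarrow> card (D i) \<le> d" "d > 0"
  shows "3 / 4 * card N \<le> card {j\<in>L. card (fanout N D j) \<le> 4 * d}"
proof -
  let ?low = "{j\<in>L. card (fanout N D j) \<le> 4 * d}"
    and ?high = "{j\<in>L. 4 * d < card (fanout N D j)}"
  have "?low \<union> ?high = L"
    by auto
  then have "card L \<le> card ?low + card ?high"
    using card_Un_le[of ?low ?high] by simp
  moreover have "4 * real (card ?high) \<le> card N"
    using assms(1,2,4-6) by (rule card_high_fanout_le)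
  ultimately show ?thesis
    using assms(3) by linarith
qed

definition separated_inputs_bound :: "nat \<Rightarrow> real \<Rightarrow> real" where
  "separated_inputs_bound n d = (3 / 4 * real n - d) / (4 * d\<^sup>2 + 1)"

lemma separated_inputs_exist:
  fixes d :: real
  assumes L: "finite L" and N: "finite N" "card N \<le> card L"
    and D: "\<And>i. i \<in> N \<Longrightarrow> D i \<subseteq> L" "\<And>i. i \<in> N \<Longrightarrow> card (D i) \<le> d"
    and E: "finite E" "card E \<le> d" and d: "d > 0"
  obtains J where "J \<subseteq> L - E" "disjoint_family_on (fanout N D) J"
    "\<And>j. j \<in> J \<Longrightarrow> card (fanout N D j) \<le> 4 * d"
    "separated_inputs_bound (card N) d \<le> card J"
proof -
  define low where "low = {j\<in>L. card (fanout N D j) \<le> 4 * d}"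
  let ?overlap = "\<lambda>j j'. fanout N D j \<inter> fanout N D j' \<noteq> {}"
  have deg: "card {w\<in>low - E. ?overlap v w} \<le> 4 * d\<^sup>2" if "v \<in> low - E" for v
  proof -
    have "card {w\<in>low - E. ?overlap v w} \<le> card (fanout N D v) * d"
      using N(1) D L finite_subset by (intro card_overlapping_fanout_le) blast+
    also have "\<dots> \<le> 4 * d * d"
      using that d by (intro mult_right_mono) (auto simp: low_def)
    finally show ?thesis
      by (simp add: power2_eq_square)
  qed
  have "finite (low - E)" "symp ?overlap"
    using L by (auto simp: low_def intro: sympI)
  from large_independent_set_exists[OF this deg]
  obtain J where J: "J \<subseteq> low - E" "pairwise (\<lambda>j j'. \<not> ?overlap j j') J"
    "card (low - E) \<le> card J * (4 * d\<^sup>2 + 1)"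
    by blast
  have "3 / 4 * card N \<le> card low"
    unfolding low_def using L N D d by (rule card_low_fanout_ge)
  moreover have "card low - card E \<le> card (low - E)"
    using E(1) by (rule diff_card_le_card_Diff)
  ultimately have "3 / 4 * card N - d \<le> card J * (4 * d\<^sup>2 + 1)"
    using J(3) E(2) by linarith
  then have "separated_inputs_bound (card N) d \<le> card J"
    by (simp add: separated_inputs_bound_def pos_divide_le_eq add_nonneg_pos)
  moreover have "J \<subseteq> L - E" "disjoint_family_on (fanout N D) J"
    using J(1,2) by (auto simp: low_def pairwise_def disjoint_family_on_def)
  moreover have "card (fanout N D j) \<le> 4 * d" if "j \<in> J" for j
    using J(1) that by (auto simp: low_def)
  ultimately show thesis
    using that by blast
qed

section \<open>Total variation distance and bit strings\<close>

lemma abs_prob_diff_le_tv_dist: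
  "\<bar>measure_pmf.prob D1 T - measure_pmf.prob D2 T\<bar> \<le> tv_dist D1 D2"
  unfolding tv_dist_def
proof (rule cSUP_upper)
  have "\<bar>measure_pmf.prob D1 S - measure_pmf.prob D2 S\<bar> \<le> 1" for S
    using measure_pmf.prob_le_1[of D1 S] measure_pmf.prob_le_1[of D2 S]
      measure_nonneg[of D1 S] measure_nonneg[of D2 S] by linarith
  then show "bdd_above (range (\<lambda>S. \<bar>measure_pmf.prob D1 S - measure_pmf.prob D2 S\<bar>))"
    by (intro bdd_aboveI2)
qed simp

lemma prob_diff_le_tv_dist: "measure_pmf.prob D1 T - measure_pmf.prob D2 T \<le> tv_dist D1 D2"
  using abs_prob_diff_le_tv_dist[of D1 T D2] by linarith

lemma tv_dist_map_pmf_le: "tv_dist (map_pmf h D1) (map_pmf h D2) \<le> tv_dist D1 D2"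
  unfolding tv_dist_def[of "map_pmf h D1"]
  by (rule cSUP_least) (simp_all add: abs_prob_diff_le_tv_dist)

lemma tv_dist_pmf_of_set_ge:
  assumes "finite B" "B \<noteq> {}" "finite (set_pmf D)"
  shows "1 - card (set_pmf D) / card B \<le> tv_dist D (pmf_of_set B)"
proof -
  have "measure_pmf.prob D (set_pmf D) = 1"
    by (simp add: measure_pmf.prob_eq_1 AE_measure_pmf)
  then show ?thesis
    using prob_diff_le_tv_dist[of D "set_pmf D" "pmf_of_set B"] prob_pmf_of_set_le[OF assms]
    by linarith
qed

definition bits :: "nat \<Rightarrow> nat set \<Rightarrow> bool list" where
  "bits k A = map (\<lambda>i. i \<in> A) [0..<k]"

lemma length_bits [simp]: "length (bits k A) = k"
  by (simp add: bits_def)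

lemma nth_bits [simp]: "i < k \<Longrightarrow> bits k A ! i \<longleftrightarrow> i \<in> A"
  by (simp add: bits_def)

lemma bits_in_bitstrings [simp]: "bits k A \<in> bitstrings k"
  by (simp add: bitstrings_def)

lemma bij_betw_bits: "bij_betw (bits k) (Pow {..<k}) (bitstrings k)"
  by (rule bij_betw_byWitness[where f' = "\<lambda>x. {i. i < k \<and> x ! i}"])
     (auto simp: bitstrings_def intro!: nth_equalityI)

lemma finite_bitstrings: "finite (bitstrings k)"
  using bij_betw_finite[OF bij_betw_bits] by simp

lemma card_bitstrings: "card (bitstrings k) = 2 ^ k"
  using bij_betw_same_card[OF bij_betw_bits] by (simp add: card_Pow)

lemma bitstrings_nonempty: "bitstrings k \<noteq> {}"
  using bits_in_bitstrings by blast

lemma set_pmf_uniform_bits: "set_pmf (uniform_bits k) = bitstrings k"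
  by (simp add: uniform_bits_def bitstrings_nonempty finite_bitstrings)

lemma uniform_bits_eq_map_random_subset: "uniform_bits k = map_pmf (bits k) (random_subset {..<k})"
  unfolding uniform_bits_def by (rule map_pmf_of_set_bij_betw[OF bij_betw_bits, symmetric]) auto

lemma hweight_bits:
  assumes "A \<subseteq> {..<k}"
  shows "hweight (bits k A) = card A"
proof -
  have "hweight (bits k A) = card (set (filter (\<lambda>i. i \<in> A) [0..<k]))"
    by (subst distinct_card) (simp_all add: hweight_def bits_def filter_map o_def)
  also have "set (filter (\<lambda>i. i \<in> A) [0..<k]) = A"
    using assms by auto
  finally show ?thesis .
qed

lemma majmod_parity_bits:
  assumes "A \<subseteq> {..<k}"
  shows "majmod p (bits k A) \<noteq> parity (bits k A) \<longleftrightarrow> majmod_parity p (card A)"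
  by (simp add: majmod_def parity_def majmod_parity_def hweight_bits[OF assms])

lemma tv_dist_short_seed_ge:
  assumes "l < n"
  shows "1 / 2 \<le> tv_dist (map_pmf f (uniform_bits l)) (map_pmf (\<lambda>x. x @ [b x]) (uniform_bits n))"
proof -
  have inj: "inj_on (\<lambda>x. x @ [b x]) (bitstrings n)"
    by (auto intro: inj_onI)
  then have target: "map_pmf (\<lambda>x. x @ [b x]) (uniform_bits n)
      = pmf_of_set ((\<lambda>x. x @ [b x]) ` bitstrings n)"
    unfolding uniform_bits_def using bitstrings_nonempty finite_bitstrings by (rule map_pmf_of_set_inj)
  have "card (f ` bitstrings l) \<le> 2 ^ l"
    using card_image_le[OF finite_bitstrings] by (simp add: card_bitstrings)
  then have "real (card (f ` bitstrings l)) / 2 ^ n \<le> 2 ^ l / 2 ^ n"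
    by (intro divide_right_mono) (simp_all flip: of_nat_le_iff)
  also have "\<dots> \<le> 2 ^ l / 2 ^ Suc l"
    using assms by (intro divide_left_mono power_increasing) auto
  finally have "1 / 2 \<le> 1 - card (f ` bitstrings l) / card ((\<lambda>x. x @ [b x]) ` bitstrings n)"
    by (simp add: card_image[OF inj] card_bitstrings)
  also have "\<dots> \<le> tv_dist (map_pmf f (uniform_bits l)) (pmf_of_set ((\<lambda>x. x @ [b x]) ` bitstrings n))"
    using tv_dist_pmf_of_set_ge[of "(\<lambda>x. x @ [b x]) ` bitstrings n" "map_pmf f (uniform_bits l)"]
    by (simp add: set_pmf_uniform_bits finite_bitstrings bitstrings_nonempty)
  finally show ?thesis
    by (simp only: target)
qed

definition ones :: "nat \<Rightarrow> bool list \<Rightarrow> nat set" where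
  "ones n x = {i. i < n \<and> x ! i}"

abbreviation (input) majmod_parity_samples :: "nat \<Rightarrow> nat \<Rightarrow> bool list pmf" where
  "majmod_parity_samples p n \<equiv> map_pmf (\<lambda>x. x @ [majmod p x \<noteq> parity x]) (uniform_bits n)"

lemma tv_dist_sets_le_tv_dist_bits:
  "tv_dist (map_pmf (\<lambda>A. (ones n (f (bits l A)), f (bits l A) ! n)) (random_subset {..<l}))
      (map_pmf (\<lambda>X. (X, majmod_parity p (card X))) (random_subset {..<n}))
    \<le> tv_dist (map_pmf f (uniform_bits l)) (majmod_parity_samples p n)"
proof -
  let ?decode = "\<lambda>x. (ones n x, x ! n)" and ?label = "\<lambda>x. x @ [majmod p x \<noteq> parity x]"
  have "?decode (?label (bits n X)) = (X, majmod_parity p (card X))"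
    if "X \<in> set_pmf (random_subset {..<n})" for X
  proof -
    have "X \<subseteq> {..<n}"
      using that by (simp add: set_pmf_random_subset)
    then show ?thesis
      using majmod_parity_bits[of X n p] by (auto simp: ones_def nth_append)
  qed
  then have target: "map_pmf ?decode (map_pmf ?label (uniform_bits n))
      = map_pmf (\<lambda>X. (X, majmod_parity p (card X))) (random_subset {..<n})"
    by (simp add: uniform_bits_eq_map_random_subset map_pmf_comp cong: map_pmf_cong)
  have sampler: "map_pmf ?decode (map_pmf f (uniform_bits l))
      = map_pmf (\<lambda>A. (ones n (f (bits l A)), f (bits l A) ! n)) (random_subset {..<l})"
    by (simp add: uniform_bits_eq_map_random_subset map_pmf_comp)
  show ?thesis
    unfolding target[symmetric] sampler[symmetric] by (rule tv_dist_map_pmf_le)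
qed

section \<open>Fibres of a map with separated inputs\<close>

locale separated_inputs =
  fixes L :: "'a set" and N :: "'b set" and F :: "'a set \<Rightarrow> 'b set" and D :: "'b \<Rightarrow> 'a set"
    and J :: "'a set"
  assumes finite_L: "finite L" and finite_N: "finite N"
    and F_subset: "A \<subseteq> L \<Longrightarrow> F A \<subseteq> N"
    and F_local: "i \<in> N \<Longrightarrow> A \<subseteq> L \<Longrightarrow> A' \<subseteq> L \<Longrightarrow> A \<inter> D i = A' \<inter> D i \<Longrightarrow>
      i \<in> F A \<longleftrightarrow> i \<in> F A'"
    and J_subset: "J \<subseteq> L"
    and disjoint_blocks: "disjoint_family_on (fanout N D) J"
begin

abbreviation block :: "'a \<Rightarrow> 'b set" where
  "block \<equiv> fanout N D"

definition block_content :: "bool \<Rightarrow> 'a set \<Rightarrow> 'a \<Rightarrow> 'b set" where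
  "block_content b Y j = (if b then F (insert j Y) else F Y) \<inter> block j"

definition inert :: "'a set \<Rightarrow> 'a set" where
  "inert Y = {j\<in>J. block_content True Y j = block_content False Y j}"

definition active :: "'a set \<Rightarrow> 'a set" where
  "active Y = {j\<in>J. (block_content True Y j = {}) \<noteq> (block_content False Y j = {})}"

definition empty_blocks :: "'b set \<Rightarrow> 'a set" where
  "empty_blocks X = {j\<in>J. X \<inter> block j = {}}"

lemma finite_J: "finite J"
  using J_subset finite_L by (rule finite_subset)

lemma block_subset: "block j \<subseteq> N"
  by (auto simp: fanout_def)

lemma finite_block: "finite (block j)"
  using block_subset finite_N by (rule finite_subset)

lemma block_content_subset: "block_content b Y j \<subseteq> block j"
  by (auto simp: block_content_def)

lemma finite_block_content: "finite (block_content b Y j)"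
  using block_content_subset finite_block by (rule finite_subset)

lemma card_L: "card L = card (L - J) + card J"
  using J_subset finite_J finite_L by (simp add: card_Diff_subset card_mono)

lemma F_block:
  assumes "Y \<subseteq> L - J" "Z \<subseteq> J" "j \<in> J"
  shows "F (Y \<union> Z) \<inter> block j = block_content (j \<in> Z) Y j"
proof -
  let ?Y = "if j \<in> Z then insert j Y else Y"
  have "i \<in> F (Y \<union> Z) \<longleftrightarrow> i \<in> F ?Y" if "i \<in> block j" for i
  proof (rule F_local)
    have "j' = j" if "j' \<in> Z" "j' \<in> D i" for j'
      using \<open>i \<in> block j\<close> that assms(2,3) disjoint_blocks
      by (fastforce simp: fanout_def disjoint_family_on_def)
    then show "(Y \<union> Z) \<inter> D i = ?Y \<inter> D i"
      by auto
  qed (use that assms J_subset in \<open>auto simp: fanout_def\<close>)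
  then show ?thesis
    by (auto simp: block_content_def)
qed

lemma F_outside_blocks:
  assumes "Y \<subseteq> L - J" "Z \<subseteq> J"
  shows "F (Y \<union> Z) - (\<Union>j\<in>J. block j) = F Y - (\<Union>j\<in>J. block j)"
proof -
  have "i \<in> F (Y \<union> Z) \<longleftrightarrow> i \<in> F Y" if "i \<in> N" "i \<notin> (\<Union>j\<in>J. block j)" for i
    using that assms J_subset by (intro F_local) (auto simp: fanout_def)
  moreover have "F (Y \<union> Z) \<subseteq> N" "F Y \<subseteq> N"
    using assms J_subset by (auto intro!: F_subset)
  ultimately show ?thesis
    by blast
qed

lemma F_Un:
  assumes "Y \<subseteq> L - J" "Z \<subseteq> J"
  shows "F (Y \<union> Z) = (F Y - (\<Union>j\<in>J. block j)) \<union> (\<Union>j\<in>J. block_content (j \<in> Z) Y j)"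
proof -
  have "F (Y \<union> Z) = (F (Y \<union> Z) - (\<Union>j\<in>J. block j)) \<union> (\<Union>j\<in>J. F (Y \<union> Z) \<inter> block j)"
    by auto
  also have "(\<Union>j\<in>J. F (Y \<union> Z) \<inter> block j) = (\<Union>j\<in>J. block_content (j \<in> Z) Y j)"
    using F_block[OF assms] by (intro SUP_cong refl)
  finally show ?thesis
    by (simp only: F_outside_blocks[OF assms])
qed

lemma F_Un_minus_inert:
  assumes "Y \<subseteq> L - J" "Z \<subseteq> J"
  shows "F (Y \<union> Z) = F (Y \<union> (Z - inert Y))"
proof -
  have "block_content (j \<in> Z) Y j = block_content (j \<in> Z - inert Y) Y j" if "j \<in> J" for j
    using that by (cases "j \<in> Z"; cases "j \<in> inert Y") (simp_all add: inert_def)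
  then show ?thesis
    using F_Un[OF assms] F_Un[OF assms(1) subset_trans[OF Diff_subset assms(2)]]
    by (simp cong: SUP_cong)
qed

lemma card_F_Un:
  assumes "Y \<subseteq> L - J" "Z \<subseteq> J"
  shows "card (F (Y \<union> Z)) = choice_sum (card (F Y - (\<Union>j\<in>J. block j)))
    (\<lambda>j. card (block_content True Y j)) (\<lambda>j. card (block_content False Y j)) J Z"
proof -
  have disjoint: "disjoint_family_on (\<lambda>j. block_content (j \<in> Z) Y j) J"
    using disjoint_blocks block_content_subset unfolding disjoint_family_on_def by blast
  have "finite (F Y)"
    using assms(1) F_subset[of Y] finite_N finite_subset by blast
  then have "card (F (Y \<union> Z))
      = card (F Y - (\<Union>j\<in>J. block j)) + card (\<Union>j\<in>J. block_content (j \<in> Z) Y j)"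
    unfolding F_Un[OF assms] using finite_J finite_block_content
    by (intro card_Un_disjoint) (auto simp: block_content_def)
  also have "card (\<Union>j\<in>J. block_content (j \<in> Z) Y j) = (\<Sum>j\<in>J. card (block_content (j \<in> Z) Y j))"
    using disjoint finite_block_content finite_J by (rule card_UN_disjoint')
  also have "\<dots> = (\<Sum>j\<in>J. if j \<in> Z then card (block_content True Y j) else card (block_content False Y j))"
    by (intro sum.cong) auto
  finally show ?thesis
    by (simp add: choice_sum_def)
qed

lemma empty_blocks_subset:
  assumes "Y \<subseteq> L - J" "Z \<subseteq> J"
  shows "empty_blocks (F (Y \<union> Z)) \<subseteq> inert Y \<union> active Y"
proof
  fix j assume "j \<in> empty_blocks (F (Y \<union> Z))"
  then show "j \<in> inert Y \<union> active Y"
    using F_block[OF assms, of j]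
    by (cases "j \<in> Z") (auto simp: empty_blocks_def inert_def active_def)
qed

lemma active_not_cong:
  assumes "j \<in> active Y" "card (block j) < p"
  shows "\<not> [card (block_content True Y j) = card (block_content False Y j)] (mod p)"
proof -
  have "card (block_content b Y j) < p" for b
    using card_mono[OF finite_block block_content_subset] assms(2) by (rule le_less_trans)
  moreover have "card (block_content True Y j) \<noteq> card (block_content False Y j)"
    using assms(1) finite_block_content by (auto simp: active_def)
  ultimately show ?thesis
    by (simp add: cong_def)
qed

definition inert_outputs :: "real \<Rightarrow> 'b set set" where
  "inert_outputs \<kappa> = (\<Union>Y\<in>{Y. Y \<subseteq> L - J \<and> \<kappa> \<le> card (inert Y)}. (\<lambda>Z. F (Y \<union> Z)) ` Pow J)"

lemma finite_inert_outputs: "finite (inert_outputs \<kappa>)"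
  using finite_J finite_L by (auto simp: inert_outputs_def)

lemma card_fibre_image_le:
  assumes "Y \<subseteq> L - J"
  shows "card ((\<lambda>Z. F (Y \<union> Z)) ` Pow J) \<le> 2 powr (real (card J) - card (inert Y))"
proof -
  have "inert Y \<subseteq> J"
    by (auto simp: inert_def)
  have "(\<lambda>Z. F (Y \<union> Z)) ` Pow J \<subseteq> (\<lambda>Z. F (Y \<union> Z)) ` Pow (J - inert Y)"
    using F_Un_minus_inert[OF assms] by blast
  then have "card ((\<lambda>Z. F (Y \<union> Z)) ` Pow J) \<le> card (Pow (J - inert Y))"
    using finite_J by (intro surj_card_le) auto
  also have "\<dots> = 2 ^ (card J - card (inert Y))"
    using finite_J \<open>inert Y \<subseteq> J\<close> by (simp add: card_Pow card_Diff_subset finite_subset)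
  finally have "real (card ((\<lambda>Z. F (Y \<union> Z)) ` Pow J)) \<le> 2 ^ (card J - card (inert Y))"
    by (simp flip: of_nat_le_iff)
  also have "\<dots> = 2 powr (real (card J) - card (inert Y))"
    using card_mono[OF finite_J \<open>inert Y \<subseteq> J\<close>] by (simp add: powr_realpow[symmetric] of_nat_diff)
  finally show ?thesis .
qed

lemma card_inert_outputs_le:
  fixes \<kappa> :: real
  shows "card (inert_outputs \<kappa>) \<le> 2 powr (card L - \<kappa>)"
proof -
  let ?Ys = "{Y. Y \<subseteq> L - J \<and> \<kappa> \<le> card (inert Y)}"
  have "finite ?Ys"
    using finite_L by simp
  then have "card (inert_outputs \<kappa>) \<le> (\<Sum>Y\<in>?Ys. card ((\<lambda>Z. F (Y \<union> Z)) ` Pow J))"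
    unfolding inert_outputs_def by (rule card_UN_le)
  then have "real (card (inert_outputs \<kappa>)) \<le> (\<Sum>Y\<in>?Ys. real (card ((\<lambda>Z. F (Y \<union> Z)) ` Pow J)))"
    by (simp flip: of_nat_sum)
  also have "\<dots> \<le> (\<Sum>Y\<in>?Ys. 2 powr (card J - \<kappa>))"
  proof (rule sum_mono)
    fix Y assume "Y \<in> ?Ys"
    then have "card ((\<lambda>Z. F (Y \<union> Z)) ` Pow J) \<le> 2 powr (real (card J) - card (inert Y))"
      by (intro card_fibre_image_le) simp
    also have "\<dots> \<le> 2 powr (card J - \<kappa>)"
      using \<open>Y \<in> ?Ys\<close> by simp
    finally show "card ((\<lambda>Z. F (Y \<union> Z)) ` Pow J) \<le> 2 powr (card J - \<kappa>)" .
  qed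
  also have "\<dots> \<le> 2 ^ card (L - J) * 2 powr (card J - \<kappa>)"
  proof -
    have "card ?Ys \<le> card (Pow (L - J))"
      using finite_L by (intro card_mono) auto
    then have "real (card ?Ys) \<le> 2 ^ card (L - J)"
      using finite_L by (simp add: card_Pow flip: of_nat_le_iff)
    then show ?thesis
      by (simp add: mult_right_mono)
  qed
  also have "\<dots> = 2 powr (card L - \<kappa>)"
    by (simp add: powr_realpow[symmetric] powr_add[symmetric] card_L add_diff_eq)
  finally show ?thesis .
qed

lemma prob_majmod_parity_fibre_le:
  assumes "Y \<subseteq> L - J" "prime p" "odd p" "\<And>j. j \<in> J \<Longrightarrow> card (block j) < p"
  shows "measure_pmf.prob (random_subset J) {Z. majmod_parity p (card (F (Y \<union> Z))) = v}
    \<le> 1 / 2 + majmod_parity_bias p (card (active Y))"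
proof -
  let ?W = "choice_sum (card (F Y - (\<Union>j\<in>J. block j)))
    (\<lambda>j. card (block_content True Y j)) (\<lambda>j. card (block_content False Y j)) J"
  have "active Y \<subseteq> J"
    by (auto simp: active_def)
  have "measure_pmf.prob (random_subset J) {Z. majmod_parity p (card (F (Y \<union> Z))) = v}
      = measure_pmf.prob (random_subset J) {Z. majmod_parity p (?W Z) = v}"
    using card_F_Un[OF assms(1)] finite_J
    by (intro measure_pmf.finite_measure_eq_AE) (auto simp: AE_measure_pmf_iff set_pmf_random_subset)
  also have "\<dots> \<le> 1 / 2 + majmod_parity_bias p (card (active Y))"
    using finite_J assms(2-4) \<open>active Y \<subseteq> J\<close> active_not_cong
    by (intro prob_majmod_parity_le) blast+
  finally show ?thesis .
qed

definition distinguisher :: "nat \<Rightarrow> real \<Rightarrow> real \<Rightarrow> ('b set \<times> bool) set" where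
  "distinguisher p \<kappa> \<theta> = {(X, v). X \<in> inert_outputs \<kappa> \<or> real (card (empty_blocks X)) \<le> \<theta> \<or>
    v \<noteq> majmod_parity p (card X)}"

lemma few_active_in_distinguisher:
  fixes t \<kappa> \<theta> :: real
  assumes "Y \<subseteq> L - J" "Z \<subseteq> J" "\<kappa> \<le> card (inert Y) \<or> card (active Y) < t" "t + \<kappa> \<le> \<theta>"
  shows "(F (Y \<union> Z), v) \<in> distinguisher p \<kappa> \<theta>"
proof (cases "\<kappa> \<le> card (inert Y)")
  case True
  then show ?thesis
    using assms(1,2) by (auto simp: distinguisher_def inert_outputs_def)
next
  case False
  have "card (empty_blocks (F (Y \<union> Z))) \<le> card (inert Y \<union> active Y)"
    using finite_J assms(1,2)
    by (intro card_mono empty_blocks_subset) (auto simp: inert_def active_def)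
  also have "\<dots> \<le> card (inert Y) + card (active Y)"
    by (rule card_Un_le)
  finally have "real (card (empty_blocks (F (Y \<union> Z)))) \<le> \<theta>"
    using False assms(3,4) by linarith
  then show ?thesis
    by (simp add: distinguisher_def)
qed

lemma prob_distinguisher_fibre_ge:
  fixes t \<kappa> \<theta> :: real
  assumes Y: "Y \<subseteq> L - J"
    and p: "prime p" "odd p" "\<And>j. j \<in> J \<Longrightarrow> card (block j) < p" and t: "t + \<kappa> \<le> \<theta>"
  shows "1 / 2 - majmod_parity_bias p t
    \<le> measure_pmf.prob (random_subset J) {Z. (F (Y \<union> Z), v) \<in> distinguisher p \<kappa> \<theta>}"
    (is "_ \<le> ?P")
proof (cases "\<kappa> \<le> card (inert Y) \<or> card (active Y) < t")
  case True
  then have "?P = 1"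
    using finite_J few_active_in_distinguisher[OF Y _ _ t]
    by (intro measure_pmf.prob_eq_1[THEN iffD2]) (auto simp: AE_measure_pmf_iff set_pmf_random_subset)
  then show ?thesis
    using majmod_parity_bias_nonneg[of p t] by simp
next
  case False
  let ?agree = "{Z. majmod_parity p (card (F (Y \<union> Z))) = v}"
  have "1 - measure_pmf.prob (random_subset J) ?agree = measure_pmf.prob (random_subset J) (- ?agree)"
    using measure_pmf.prob_compl[of ?agree "random_subset J"] by (simp add: Compl_eq_Diff_UNIV)
  also have "\<dots> \<le> ?P"
    by (intro measure_pmf.finite_measure_mono) (auto simp: distinguisher_def)
  finally have "1 - measure_pmf.prob (random_subset J) ?agree \<le> ?P" .
  moreover have "majmod_parity_bias p (card (active Y)) \<le> majmod_parity_bias p t"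
    using False by (intro majmod_parity_bias_antimono) simp
  moreover have "measure_pmf.prob (random_subset J) ?agree
      \<le> 1 / 2 + majmod_parity_bias p (card (active Y))"
    using Y p by (rule prob_majmod_parity_fibre_le)
  ultimately show ?thesis
    by linarith
qed

lemma prob_distinguisher_sampler_ge:
  fixes t \<kappa> \<theta> :: real
  assumes g: "\<And>Y Z. Y \<subseteq> L - J \<Longrightarrow> Z \<subseteq> J \<Longrightarrow> g (Y \<union> Z) = g Y"
    and p: "prime p" "odd p" "\<And>j. j \<in> J \<Longrightarrow> card (block j) < p" and t: "t + \<kappa> \<le> \<theta>"
  shows "1 / 2 - majmod_parity_bias p t
    \<le> measure_pmf.prob (random_subset L) {A. (F A, g A) \<in> distinguisher p \<kappa> \<theta>}"
proof -
  let ?T = "{A. (F A, g A) \<in> distinguisher p \<kappa> \<theta>}"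
  have L: "(L - J) \<union> J = L"
    using J_subset by auto
  have "random_subset L
      = bind_pmf (random_subset (L - J)) (\<lambda>Y. map_pmf (\<lambda>Z. Y \<union> Z) (random_subset J))"
    using random_subset_Un[of "L - J" J, unfolded L] finite_L finite_J by blast
  moreover have "1 / 2 - majmod_parity_bias p t
      \<le> measure_pmf.prob (map_pmf (\<lambda>Z. Y \<union> Z) (random_subset J)) ?T"
    if "Y \<in> set_pmf (random_subset (L - J))" for Y
  proof -
    have Y: "Y \<subseteq> L - J"
      using that finite_L by (simp add: set_pmf_random_subset)
    have "1 / 2 - majmod_parity_bias p t
        \<le> measure_pmf.prob (random_subset J) {Z. (F (Y \<union> Z), g Y) \<in> distinguisher p \<kappa> \<theta>}"
      using Y p t by (rule prob_distinguisher_fibre_ge)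
    also have "\<dots> = measure_pmf.prob (random_subset J) ((\<lambda>Z. Y \<union> Z) -` ?T)"
      using g[OF Y] finite_J
      by (intro measure_pmf.finite_measure_eq_AE) (auto simp: AE_measure_pmf_iff set_pmf_random_subset)
    finally show ?thesis
      by simp
  qed
  ultimately show ?thesis
    by (simp add: prob_bind_pmf_ge)
qed

lemma prob_inert_outputs_le:
  fixes \<kappa> :: real
  shows "measure_pmf.prob (random_subset N) (inert_outputs \<kappa>)
    \<le> 2 powr (real (card L) - card N - \<kappa>)"
proof -
  have "measure_pmf.prob (random_subset N) (inert_outputs \<kappa>)
      \<le> card (inert_outputs \<kappa>) / card (Pow N)"
    using finite_N finite_inert_outputs by (intro prob_pmf_of_set_le) auto
  also have "\<dots> \<le> 2 powr (card L - \<kappa>) / 2 powr card N"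
    using finite_N card_inert_outputs_le by (simp add: card_Pow powr_realpow divide_right_mono)
  also have "\<dots> = 2 powr (real (card L) - card N - \<kappa>)"
    by (simp add: powr_diff[symmetric] algebra_simps)
  finally show ?thesis .
qed

lemma prob_distinguisher_target_le:
  fixes q \<kappa> :: real
  assumes "0 \<le> q" "\<And>j. j \<in> J \<Longrightarrow> q \<le> (1 / 2) ^ card (block j)"
  shows "measure_pmf.prob (random_subset N)
      {X. (X, majmod_parity p (card X)) \<in> distinguisher p \<kappa> (q * card J / 2)}
    \<le> 2 powr (real (card L) - card N - \<kappa>) + exp (- q\<^sup>2 * card J / 2)"
proof -
  let ?few = "{X. card (empty_blocks X) \<le> q * card J / 2}"
  have "{X. (X, majmod_parity p (card X)) \<in> distinguisher p \<kappa> (q * card J / 2)}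
      = inert_outputs \<kappa> \<union> ?few"
    by (auto simp: distinguisher_def)
  then have "measure_pmf.prob (random_subset N)
      {X. (X, majmod_parity p (card X)) \<in> distinguisher p \<kappa> (q * card J / 2)}
    \<le> measure_pmf.prob (random_subset N) (inert_outputs \<kappa>)
      + measure_pmf.prob (random_subset N) ?few"
    using measure_Un_le[of "inert_outputs \<kappa>" "measure_pmf (random_subset N)" ?few] by simp
  also have "measure_pmf.prob (random_subset N) ?few \<le> exp (- q\<^sup>2 * card J / 2)"
    unfolding empty_blocks_def using finite_J finite_N disjoint_blocks assms
    by (intro prob_few_avoided_blocks_le block_subset)
  finally show ?thesis
    using prob_inert_outputs_le[of \<kappa>] by linarith
qed

lemma tv_dist_sampler_ge:
  fixes q \<kappa> t :: real
  assumes g: "\<And>Y Z. Y \<subseteq> L - J \<Longrightarrow> Z \<subseteq> J \<Longrightarrow> g (Y \<union> Z) = g Y"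
    and p: "prime p" "odd p" "\<And>j. j \<in> J \<Longrightarrow> card (block j) < p"
    and q: "0 \<le> q" "\<And>j. j \<in> J \<Longrightarrow> q \<le> (1 / 2) ^ card (block j)"
    and t: "t + \<kappa> \<le> q * card J / 2"
  shows "1 / 2 - majmod_parity_bias p t - 2 powr (real (card L) - card N - \<kappa>)
      - exp (- q\<^sup>2 * card J / 2)
    \<le> tv_dist (map_pmf (\<lambda>A. (F A, g A)) (random_subset L))
        (map_pmf (\<lambda>X. (X, majmod_parity p (card X))) (random_subset N))"
    (is "_ \<le> tv_dist ?sampler ?target")
proof -
  let ?T = "distinguisher p \<kappa> (q * card J / 2)"
  have "1 / 2 - majmod_parity_bias p t \<le> measure_pmf.prob ?sampler ?T"
    using prob_distinguisher_sampler_ge[OF g p t] by (simp add: vimage_def)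
  moreover have "measure_pmf.prob ?target ?T
      \<le> 2 powr (real (card L) - card N - \<kappa>) + exp (- q\<^sup>2 * card J / 2)"
    using prob_distinguisher_target_le[OF q] by (simp add: vimage_def)
  ultimately show ?thesis
    using prob_diff_le_tv_dist[of ?sampler ?T ?target] by linarith
qed

end

section \<open>Local samplers\<close>

lemma is_local_dependencies:
  fixes d :: real
  assumes "is_local d l m f"
  obtains S where "\<And>i. i < m \<Longrightarrow> S i \<subseteq> {..<l}" "\<And>i. i < m \<Longrightarrow> card (S i) \<le> d"
    "\<And>i A A'. i < m \<Longrightarrow> A \<inter> S i = A' \<inter> S i \<Longrightarrow> f (bits l A) ! i \<longleftrightarrow> f (bits l A') ! i"
proof -
  have "\<forall>i\<in>{..<m}. \<exists>S. S \<subseteq> {..<l} \<and> real (card S) \<le> d \<and>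
      (\<forall>x\<in>bitstrings l. \<forall>y\<in>bitstrings l. (\<forall>j\<in>S. x ! j = y ! j) \<longrightarrow> f x ! i = f y ! i)"
    using assms by (simp add: is_local_def)
  from bchoice[OF this] obtain S where S: "\<forall>i\<in>{..<m}. S i \<subseteq> {..<l} \<and> real (card (S i)) \<le> d \<and>
      (\<forall>x\<in>bitstrings l. \<forall>y\<in>bitstrings l. (\<forall>j\<in>S i. x ! j = y ! j) \<longrightarrow> f x ! i = f y ! i)" ..
  show thesis
  proof (rule that)
    fix i A A' assume i: "i < m" and eq: "A \<inter> S i = A' \<inter> S i"
    have "bits l A ! j = bits l A' ! j" if "j \<in> S i" for j
    proof -
      have "j < l"
        using S i that by auto
      then show ?thesis
        using eq that by auto
    qed
    then show "f (bits l A) ! i \<longleftrightarrow> f (bits l A') ! i"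
      using S i bits_in_bitstrings by (metis lessThan_iff)
  qed (use S in auto)
qed

lemma powr_minus_le_half_power:
  assumes "real k \<le> x"
  shows "2 powr (- x) \<le> (1 / 2) ^ k"
proof -
  have "2 powr (- x) \<le> 2 powr (- real k)"
    using assms by simp
  also have "\<dots> = (1 / 2) ^ k"
    by (simp add: powr_minus powr_realpow power_one_over inverse_eq_divide)
  finally show ?thesis .
qed

lemma tv_dist_separated_inputs_ge:
  fixes c \<kappa> s t :: real
  assumes dep: "\<And>i A A'. i \<le> n \<Longrightarrow> A \<inter> S i = A' \<inter> S i \<Longrightarrow> f (bits l A) ! i \<longleftrightarrow> f (bits l A') ! i"
    and J: "J \<subseteq> {..<l} - S n" "disjoint_family_on (fanout {..<n} S) J" "s \<le> card J"
    and block: "\<And>j. j \<in> J \<Longrightarrow> card (fanout {..<n} S j) \<le> c" "c < p"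
    and p: "prime p" "odd p" and t: "t + \<kappa> \<le> 2 powr (- c) * s / 2"
  shows "1 / 2 - majmod_parity_bias p t - 2 powr (real l - n - \<kappa>) - exp (- (2 powr (- c))\<^sup>2 * s / 2)
    \<le> tv_dist (map_pmf f (uniform_bits l)) (majmod_parity_samples p n)"
proof -
  interpret separated_inputs "{..<l}" "{..<n}" "\<lambda>A. ones n (f (bits l A))" S J
  proof unfold_locales
    show "i \<in> ones n (f (bits l A)) \<longleftrightarrow> i \<in> ones n (f (bits l A'))"
      if "i \<in> {..<n}" "A \<inter> S i = A' \<inter> S i" for i A A'
      using dep[of i A A'] that by (simp add: ones_def)
  qed (use J in \<open>auto simp: ones_def\<close>)
  define q where "q = 2 powr (- c)"
  have "q * s \<le> q * card J" and "q\<^sup>2 * s \<le> q\<^sup>2 * card J"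
    using J(3) by (simp_all add: q_def mult_left_mono)
  have "1 / 2 - majmod_parity_bias p t - 2 powr (real (card {..<l}) - card {..<n} - \<kappa>)
      - exp (- q\<^sup>2 * card J / 2)
    \<le> tv_dist (map_pmf (\<lambda>A. (ones n (f (bits l A)), f (bits l A) ! n)) (random_subset {..<l}))
        (map_pmf (\<lambda>X. (X, majmod_parity p (card X))) (random_subset {..<n}))"
  proof (rule tv_dist_sampler_ge[OF _ p])
    show "f (bits l (Y \<union> Z)) ! n \<longleftrightarrow> f (bits l Y) ! n" if "Z \<subseteq> J" for Y Z
      using that J(1) by (intro dep) auto
    show "card (fanout {..<n} S j) < p" if "j \<in> J" for j
      using block(1)[OF that] block(2) by linarith
    show "q \<le> (1 / 2) ^ card (fanout {..<n} S j)" if "j \<in> J" for j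
      unfolding q_def using block(1)[OF that] by (rule powr_minus_le_half_power)
    show "t + \<kappa> \<le> q * card J / 2"
      using t \<open>q * s \<le> q * card J\<close> unfolding q_def by linarith
  qed (simp add: q_def)
  moreover have "exp (- q\<^sup>2 * card J / 2) \<le> exp (- q\<^sup>2 * s / 2)"
    using \<open>q\<^sup>2 * s \<le> q\<^sup>2 * card J\<close> by simp
  ultimately show ?thesis
    using tv_dist_sets_le_tv_dist_bits[of n f l p] unfolding q_def card_lessThan by linarith
qed

lemma tv_dist_local_ge:
  fixes d \<kappa> t :: real and n l p :: nat
  defines "s \<equiv> separated_inputs_bound n d"
  assumes local: "is_local d l (n + 1) f" and "n \<le> l" and p: "prime p" "odd p"
    and d: "0 < d" "4 * d < p" and t: "t + \<kappa> \<le> 2 powr (- (4 * d)) * s / 2"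
  shows "1 / 2 - majmod_parity_bias p t - 2 powr (real l - n - \<kappa>)
      - exp (- (2 powr (- (4 * d)))\<^sup>2 * s / 2)
    \<le> tv_dist (map_pmf f (uniform_bits l)) (majmod_parity_samples p n)"
proof -
  obtain S where S: "\<And>i. i < n + 1 \<Longrightarrow> S i \<subseteq> {..<l}" "\<And>i. i < n + 1 \<Longrightarrow> card (S i) \<le> d"
    and dep: "\<And>i A A'. i < n + 1 \<Longrightarrow> A \<inter> S i = A' \<inter> S i \<Longrightarrow> f (bits l A) ! i \<longleftrightarrow> f (bits l A') ! i"
    using is_local_dependencies[OF local] by metis
  obtain J where J: "J \<subseteq> {..<l} - S n" "disjoint_family_on (fanout {..<n} S) J"
    "\<And>j. j \<in> J \<Longrightarrow> card (fanout {..<n} S j) \<le> 4 * d" "s \<le> card J"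
    using separated_inputs_exist[of "{..<l}" "{..<n}" S d "S n"] S finite_subset[OF S(1)[of n]] d(1)
      \<open>n \<le> l\<close> by (auto simp: s_def)
  show ?thesis
  proof (rule tv_dist_separated_inputs_ge)
    show "f (bits l A) ! i \<longleftrightarrow> f (bits l A') ! i" if "i \<le> n" "A \<inter> S i = A' \<inter> S i" for i A A'
      using that by (intro dep) auto
    show "card (fanout {..<n} S j) \<le> 4 * d" if "j \<in> J" for j
      using that by (rule J(3))
  qed (fact J(1,2,4) d(2) p t)+
qed

lemma tv_dist_local_uniform_ge:
  fixes d k t \<kappa> P Q \<eta> :: real and n l p :: nat
  defines "q \<equiv> 2 powr (- (4 * d))" and "s \<equiv> separated_inputs_bound n d"
  assumes local: "is_local d l (n + 1) f" and l: "real l \<le> real n + k"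
    and p: "prime p" "P \<le> p" "p \<le> Q" and P: "3 \<le> P" "4 * d < P"
    and d: "0 < d" and t: "0 \<le> t" "t + \<kappa> \<le> q * s / 2"
    and errors: "1 / (2 * P) \<le> \<eta>" "Q / 2 * exp (- t / (32 * Q\<^sup>2)) \<le> \<eta>"
      "2 powr (k - \<kappa>) \<le> \<eta>" "exp (- q\<^sup>2 * s / 2) \<le> \<eta>"
  shows "1 / 2 - 4 * \<eta> \<le> tv_dist (map_pmf f (uniform_bits l)) (majmod_parity_samples p n)"
proof (cases "l < n")
  case True
  have "0 \<le> \<eta>"
    using errors(4) by (rule order_trans[rotated]) simp
  then show ?thesis
    using tv_dist_short_seed_ge[OF True, of f "\<lambda>x. majmod p x \<noteq> parity x"] by simp
next
  case False
  have "odd p"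
    using p(1,2) P(1) by (intro prime_odd_nat) auto
  then have "1 / 2 - majmod_parity_bias p t - 2 powr (real l - n - \<kappa>) - exp (- q\<^sup>2 * s / 2)
      \<le> tv_dist (map_pmf f (uniform_bits l)) (majmod_parity_samples p n)"
    unfolding q_def s_def using False p P d
    by (intro tv_dist_local_ge local t(2)[unfolded q_def s_def]) auto
  moreover have "majmod_parity_bias p t \<le> 1 / (2 * P) + Q / 2 * exp (- t / (32 * Q\<^sup>2))"
    using p(2,3) P(1) t(1) by (intro majmod_parity_bias_le) auto
  moreover have "2 powr (real l - n - \<kappa>) \<le> 2 powr (k - \<kappa>)"
    using l by simp
  ultimately show ?thesis
    using errors by linarith
qed

lemma powr_mult_log: "0 < x \<Longrightarrow> 0 < b \<Longrightarrow> b \<noteq> 1 \<Longrightarrow> b powr (c * log b x) = x powr c"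
  by (simp add: mult.commute[of c] powr_powr[symmetric])

lemma eventually_separated_inputs_bound_ge:
  fixes \<epsilon> \<gamma> :: real
  assumes "0 < \<epsilon>" "0 < \<gamma>" "4 * \<epsilon> < 1 - \<gamma>"
  shows "\<forall>\<^sub>F n::nat in sequentially. real n powr \<gamma> + real n powr \<gamma>
    \<le> real n powr (- 4 * \<epsilon>) * separated_inputs_bound n (\<epsilon> * log 2 n) / 2"
  unfolding separated_inputs_bound_def using assms by real_asymp

lemma eventually_exp_separated_inputs_bound_le:
  fixes \<epsilon> :: real
  assumes "0 < \<epsilon>" "8 * \<epsilon> < 1"
  shows "\<forall>\<^sub>F n::nat in sequentially.
    exp (- (real n powr (- 4 * \<epsilon>))\<^sup>2 * separated_inputs_bound n (\<epsilon> * log 2 n) / 2) \<le> 1 / log 2 n"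
  unfolding separated_inputs_bound_def using assms by real_asymp

lemma eventually_tv_dist_log_local_ge:
  fixes \<alpha> \<gamma> \<delta> \<epsilon> c1 c2 :: real
  assumes "0 < \<alpha>" "2 * \<alpha> < \<gamma>" "\<delta> < \<gamma>" "0 < \<epsilon>" "8 * \<epsilon> < 1 - \<gamma>" "0 < c1" "0 < c2"
  shows "\<forall>\<^sub>F n in sequentially. \<forall>p l f.
      prime p \<and> c1 * real n powr \<alpha> \<le> real p \<and> real p \<le> c2 * real n powr \<alpha> \<and>
      real l \<le> real n + real n powr \<delta> \<and> is_local (\<epsilon> * log 2 (real n)) l (n + 1) f \<longrightarrow>
      1 / 2 - 4 / log 2 (real n) \<le> tv_dist (map_pmf f (uniform_bits l)) (majmod_parity_samples p n)"
proof -
  have "0 < \<gamma>"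
    using assms(1,2) by linarith
  have "\<forall>\<^sub>F n::nat in sequentially. n \<ge> 2"
    by (rule eventually_ge_at_top)
  moreover have "\<forall>\<^sub>F n::nat in sequentially. 3 \<le> c1 * real n powr \<alpha>"
    using assms by real_asymp
  moreover have "\<forall>\<^sub>F n::nat in sequentially. 4 * (\<epsilon> * log 2 n) < c1 * real n powr \<alpha>"
    using assms by real_asymp
  moreover have "\<forall>\<^sub>F n::nat in sequentially. 1 / (2 * (c1 * real n powr \<alpha>)) \<le> 1 / log 2 n"
    using assms by real_asymp
  moreover have "\<forall>\<^sub>F n::nat in sequentially.
      c2 * real n powr \<alpha> / 2 * exp (- (real n powr \<gamma>) / (32 * (c2 * real n powr \<alpha>)\<^sup>2)) \<le> 1 / log 2 n"
    using assms by real_asymp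
  moreover have "\<forall>\<^sub>F n::nat in sequentially.
      2 powr (real n powr \<delta> - real n powr \<gamma>) \<le> 1 / log 2 n"
    using assms(3) \<open>0 < \<gamma>\<close> by real_asymp
  moreover have "\<forall>\<^sub>F n::nat in sequentially. real n powr \<gamma> + real n powr \<gamma>
      \<le> real n powr (- 4 * \<epsilon>) * separated_inputs_bound n (\<epsilon> * log 2 n) / 2"
    using assms(4,5) \<open>0 < \<gamma>\<close> by (intro eventually_separated_inputs_bound_ge) auto
  moreover have "\<forall>\<^sub>F n::nat in sequentially.
      exp (- (real n powr (- 4 * \<epsilon>))\<^sup>2 * separated_inputs_bound n (\<epsilon> * log 2 n) / 2) \<le> 1 / log 2 n"
    using assms(4,5) \<open>0 < \<gamma>\<close> by (intro eventually_exp_separated_inputs_bound_le) auto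
  ultimately show ?thesis
  proof eventually_elim
    case (elim n)
    have q: "2 powr (- (4 * (\<epsilon> * log 2 n))) = real n powr (- 4 * \<epsilon>)"
      using powr_mult_log[of "real n" 2 "- 4 * \<epsilon>"] elim(1) by (simp add: mult_ac)
    have "1 / 2 - 4 * (1 / log 2 n)
        \<le> tv_dist (map_pmf f (uniform_bits l)) (majmod_parity_samples p n)"
      if "prime p" "c1 * real n powr \<alpha> \<le> real p" "real p \<le> c2 * real n powr \<alpha>"
        "real l \<le> real n + real n powr \<delta>" "is_local (\<epsilon> * log 2 n) l (n + 1) f" for p l f
      using that elim \<open>0 < \<epsilon>\<close> unfolding q[symmetric]
      by (intro tv_dist_local_uniform_ge[where t = "real n powr \<gamma>" and \<kappa> = "real n powr \<gamma>"]) auto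
    then show ?case
      by simp
  qed
qed

theorem theorem5p1:
  fixes \<delta> \<alpha> :: real
  assumes "0 \<le> \<delta>" "\<delta> < 1" "\<delta> / 3 < \<alpha>" "\<alpha> < 1 / 3"
  shows "\<exists>\<epsilon>>0. \<forall>c1 c2 :: real. 0 < c1 \<and> c1 \<le> c2 \<longrightarrow>
          (\<exists>C>0. \<exists>n0::nat. \<forall>n \<ge> n0. \<forall>p::nat. \<forall>l::nat. \<forall>f.
             prime p \<and> c1 * real n powr \<alpha> \<le> real p \<and> real p \<le> c2 * real n powr \<alpha> \<and>
             real l \<le> real n + real n powr \<delta> \<and>
             is_local (\<epsilon> * log 2 (real n)) l (n + 1) f \<longrightarrow>
             tv_dist (map_pmf f (uniform_bits l))
                     (map_pmf (\<lambda>x. x @ [majmod p x \<noteq> parity x]) (uniform_bits n))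
               \<ge> 1 / 2 - C / log 2 (real n))"
proof -
  obtain \<gamma> where \<gamma>: "max \<delta> (2 * \<alpha>) < \<gamma>" "\<gamma> < 1"
    using assms dense[of "max \<delta> (2 * \<alpha>)" 1] by auto
  show ?thesis
  proof (rule exI[of _ "(1 - \<gamma>) / 9"], intro conjI allI impI)
    fix c1 c2 :: real
    assume "0 < c1 \<and> c1 \<le> c2"
    then show "\<exists>C>0. \<exists>n0::nat. \<forall>n \<ge> n0. \<forall>p::nat. \<forall>l::nat. \<forall>f.
        prime p \<and> c1 * real n powr \<alpha> \<le> real p \<and> real p \<le> c2 * real n powr \<alpha> \<and>
        real l \<le> real n + real n powr \<delta> \<and> is_local ((1 - \<gamma>) / 9 * log 2 (real n)) l (n + 1) f \<longrightarrow>
        tv_dist (map_pmf f (uniform_bits l)) (majmod_parity_samples p n) \<ge> 1 / 2 - C / log 2 (real n)"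
      using eventually_tv_dist_log_local_ge[of \<alpha> \<gamma> \<delta> "(1 - \<gamma>) / 9" c1 c2] \<gamma> assms
      unfolding eventually_sequentially by (intro exI[of _ 4]) auto
  qed (use \<gamma> in simp)
qed

end
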